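(* For every integer $n>1$, \[\zeta(n)=\frac{1}{n!}\lim_{z\to0^+}\frac{\mathrm d^n}{\mathrm dz^n}\prod_{j=0}^{n-1}\Gamma\!\left(1-z\,e(j/n)\right),\] where $\zeta$ is the Riemann zeta function, $\Gamma$ is Euler's gamma function, and $e(x):=e^{2\pi ix}$. *)

theory Defs
  imports "HOL-Complex_Analysis.Complex_Analysis"
begin

text \<open>
  The Riemann zeta function on the half-plane \<open>Re s > 1\<close>, where it is given by its Dirichlet
  series. The series diverges for \<open>Re s \<le> 1\<close>, so the constant carries no information there; in
  particular it is not the analytic continuation.
\<close>
definition zeta :: "complex \<Rightarrow> complex" where
  "zeta s = (\<Sum>k. 1 / of_nat (Suc k) powr s)"

definition e :: "real \<Rightarrow> complex" where
  "e x = exp (2 * of_real pi * \<i> * of_real x)"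

end

theory Submission
  imports Defs "HOL-Computational_Algebra.Fundamental_Theorem_Algebra"
begin

text \<open>
  By the Weierstrass product, \<open>\<Prod>\<^sub>w \<Gamma>(1 - z w)\<close> over the \<open>n\<close>-th roots of unity is the reciprocal of
  \<open>\<Prod>\<^sub>k (1 - z\<^sup>n / k\<^sup>n) = 1 - \<zeta>(n) z\<^sup>n + O(z\<^sup>2\<^sup>n)\<close>. Hence it is \<open>1 + \<zeta>(n) z\<^sup>n + o(z\<^sup>n)\<close> near
  \<open>0\<close>, and Cauchy's inequality on small circles reads off its \<open>n\<close>-th derivative at \<open>0\<close>.
\<close>

section \<open>Estimates for finite products near 1\<close>

text \<open>After expanding the product, what remains is a sum of monomials in the
  \<open>a k\<close>, of degree at least 2 in the first bound and at least 1 in the second; the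
  triangle inequality gives the same sum with every \<open>a k\<close> replaced by its norm. The
  second bound is carried along because inserting \<open>x\<close> adds \<open>a x\<close> times the
  remainder of degree at least 1.\<close>

lemma norm_prod_one_minus_linear_le:
  fixes a :: "'i \<Rightarrow> 'a :: {real_normed_field}"
  assumes "finite A"
  shows "norm ((\<Prod>k\<in>A. 1 - a k) - 1 + (\<Sum>k\<in>A. a k))
           \<le> (\<Prod>k\<in>A. 1 + norm (a k)) - 1 - (\<Sum>k\<in>A. norm (a k))
       \<and> norm ((\<Prod>k\<in>A. 1 - a k) - 1) \<le> (\<Prod>k\<in>A. 1 + norm (a k)) - 1"
  using assms
proof induction
  case (insert x A)
  let ?P = "\<Prod>k\<in>A. 1 - a k" and ?Q = "\<Prod>k\<in>A. 1 + norm (a k)"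
  have eq1: "(\<Prod>k\<in>insert x A. 1 - a k) - 1 + (\<Sum>k\<in>insert x A. a k)
               = (?P - 1 + (\<Sum>k\<in>A. a k)) - a x * (?P - 1)"
    using insert.hyps by (simp add: algebra_simps)
  have eq2: "(\<Prod>k\<in>insert x A. 1 - a k) - 1 = (?P - 1) - a x * (?P - 1) - a x"
    using insert.hyps by (simp add: algebra_simps)
  have step: "norm (a x * (?P - 1)) \<le> norm (a x) * (?Q - 1)"
    unfolding norm_mult using insert.IH by (intro mult_left_mono) auto
  have "norm ((\<Prod>k\<in>insert x A. 1 - a k) - 1 + (\<Sum>k\<in>insert x A. a k))
          \<le> (?Q - 1 - (\<Sum>k\<in>A. norm (a k))) + norm (a x) * (?Q - 1)"
    unfolding eq1 by (rule order_trans[OF norm_triangle_ineq4]) (use insert.IH step in linarith)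
  moreover have "norm ((\<Prod>k\<in>insert x A. 1 - a k) - 1)
          \<le> (?Q - 1) + norm (a x) * (?Q - 1) + norm (a x)"
    unfolding eq2
    using norm_triangle_ineq4[of "?P - 1 - a x * (?P - 1)" "a x"]
      norm_triangle_ineq4[of "?P - 1" "a x * (?P - 1)"] insert.IH step by linarith
  ultimately show ?case
    using insert.hyps by (simp add: algebra_simps)
qed simp

text \<open>With \<open>t\<close> the sum of the norms, the majorant is at most
  \<open>exp t - 1 - t\<close>, hence at most \<open>t^2\<close> on the unit interval. The bound
  does not depend on the size of \<open>A\<close>, so it survives passage to an infinite
  product.\<close>

lemma norm_prod_one_minus_quadratic_le:
  fixes a :: "'i \<Rightarrow> 'a :: {real_normed_field}"
  assumes "finite A" "(\<Sum>k\<in>A. norm (a k)) \<le> s" "s \<le> 1"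
  shows "norm ((\<Prod>k\<in>A. 1 - a k) - 1 + (\<Sum>k\<in>A. a k)) \<le> s\<^sup>2"
proof -
  define t where "t = (\<Sum>k\<in>A. norm (a k))"
  have t: "0 \<le> t" "t \<le> s"
    using assms by (auto simp: t_def intro: sum_nonneg)
  have "(\<Prod>k\<in>A. 1 + norm (a k)) \<le> (\<Prod>k\<in>A. exp (norm (a k)))"
    by (intro prod_mono) auto
  also have "\<dots> = exp t"
    using assms by (simp add: exp_sum t_def)
  also have "\<dots> \<le> 1 + t + t\<^sup>2"
    using t assms by (intro exp_bound) auto
  finally have "norm ((\<Prod>k\<in>A. 1 - a k) - 1 + (\<Sum>k\<in>A. a k)) \<le> t\<^sup>2"
    using norm_prod_one_minus_linear_le[OF assms(1), of a] by (simp add: t_def)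
  also have "\<dots> \<le> s\<^sup>2"
    using t by (intro power_mono)
  finally show ?thesis .
qed

section \<open>Roots of unity and the Weierstrass product\<close>

text \<open>The polynomial \<open>X^n - 1\<close> splits into distinct linear factors; evaluate at
  \<open>1 / x\<close> and multiply by \<open>x ^ n\<close>.\<close>

lemma prod_one_minus_roots_unity:
  fixes x :: complex
  assumes "n > 0"
  shows "(\<Prod>w | w ^ n = 1. 1 - x * w) = 1 - x ^ n"
proof (cases "x = 0")
  case True
  then show ?thesis using assms by simp
next
  case False
  define p :: "complex poly" where "p = monom 1 n - 1"
  have poly_p: "poly p y = y ^ n - 1" for y
    by (simp add: p_def poly_monom)
  have deg: "degree p = n"
    unfolding p_def diff_conv_add_uminus using assms
    by (subst degree_add_eq_left) (auto simp: degree_monom_eq)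
  have lead: "lead_coeff p = 1"
    using assms by (simp add: deg) (simp add: p_def)
  \<comment> \<open>A root of the derivative \<open>n X^(n-1)\<close> can only be 0, which is not a
    root of \<open>p\<close>.\<close>
  have "rsquarefree p"
    unfolding rsquarefree_roots
    using assms by (auto simp: poly_p p_def pderiv_diff pderiv_monom poly_monom power_0_left)
  then have "smult (lead_coeff p) (\<Prod>w | poly p w = 0. [:- w, 1:]) = p"
    by (rule complex_poly_decompose_rsquarefree)
  then have "poly (\<Prod>w | w ^ n = 1. [:- w, 1:]) (1 / x) = poly p (1 / x)"
    by (simp add: lead poly_p)
  then have root: "(\<Prod>w | w ^ n = 1. 1 / x - w) = (1 / x) ^ n - 1"
    by (simp add: poly_prod poly_p)
  have "(\<Prod>w | w ^ n = 1. 1 - x * w) = (\<Prod>w | w ^ n = 1. x * (1 / x - w))"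
    using False by (intro prod.cong) (auto simp: field_simps)
  also have "\<dots> = x ^ n * ((1 / x) ^ n - 1)"
    using assms by (simp only: prod.distrib root prod_constant card_roots_unity_eq)
  also have "\<dots> = 1 - x ^ n"
    using False by (simp add: field_simps)
  finally show ?thesis .
qed

text \<open>
  In the product of the Weierstrass factorisations the exponential factors cancel because the
  roots of unity sum to zero.
\<close>
lemma prod_rGamma_roots_unity:
  fixes z :: complex
  assumes "n > 1"
  shows "(\<lambda>N. \<Prod>k<N. 1 - z ^ n / of_nat (Suc k) ^ n)
           \<longlonglongrightarrow> (\<Prod>w | w ^ n = 1. rGamma (1 - z * w))"
proof (cases "z = 0")
  case True
  then show ?thesis using assms by (simp add: power_0_left)
next
  case False
  let ?R = "{w :: complex. w ^ n = 1}"
  have fin: "finite ?R"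
    using assms by (intro finite_roots_unity) auto
  \<comment> \<open>Needs \<open>n > 1\<close>: for \<open>n = 1\<close> the only root is 1 and the
    sum is \<open>c\<close>.\<close>
  have sum0: "(\<Sum>w\<in>?R. c * w) = 0" for c
    using sum_roots_unity[OF assms] by (simp flip: sum_distrib_left)
  have nz: "z * w \<noteq> 0" if "w \<in> ?R" for w
    using that False assms by (auto simp: power_0_left)
  \<comment> \<open>Dividing by \<open>- (z * w)\<close> turns the approximants of
    \<open>rGamma (- (z * w))\<close> into those of \<open>rGamma (1 - z * w)\<close>. All exponents
    have the form constant times \<open>w\<close>, ready for \<open>sum0\<close>.\<close>
  have W: "rGamma_series_Weierstrass (- (z * w)) N / (- (z * w)) =
      exp (- (euler_mascheroni * z) * w) * (\<Prod>k<N. (1 - z / of_nat (Suc k) * w) * exp (z / of_nat (Suc k) * w))"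
    if "w \<in> ?R" for w N
    using nz[OF that]
    by (simp add: rGamma_series_Weierstrass_def prod.atLeast1_atMost_eq mult_ac
             del: of_nat_Suc)
  have "(\<Prod>w\<in>?R. rGamma_series_Weierstrass (- (z * w)) N / (- (z * w)))
          = (\<Prod>k<N. 1 - z ^ n / of_nat (Suc k) ^ n)" for N
  proof -
    have "(\<Prod>w\<in>?R. rGamma_series_Weierstrass (- (z * w)) N / (- (z * w)))
        = (\<Prod>w\<in>?R. exp (- (euler_mascheroni * z) * w))
            * (\<Prod>k<N. (\<Prod>w\<in>?R. 1 - z / of_nat (Suc k) * w) * (\<Prod>w\<in>?R. exp (z / of_nat (Suc k) * w)))"
      unfolding prod.distrib[symmetric]
      by (subst prod.swap) (simp only: W prod.distrib cong: prod.cong)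
    then show ?thesis
      using assms
      by (simp only: exp_sum[OF fin, symmetric] sum0 exp_zero mult_1_left mult_1_right
          prod_one_minus_roots_unity power_divide)
  qed
  moreover have "(\<lambda>N. \<Prod>w\<in>?R. rGamma_series_Weierstrass (- (z * w)) N / (- (z * w)))
      \<longlonglongrightarrow> (\<Prod>w\<in>?R. rGamma (- (z * w)) / (- (z * w)))"
    using nz by (intro tendsto_prod tendsto_divide rGamma_Weierstrass_complex tendsto_const) auto
  moreover have "(\<Prod>w\<in>?R. rGamma (- (z * w)) / (- (z * w))) = (\<Prod>w\<in>?R. rGamma (1 - z * w))"
  proof (intro prod.cong refl)
    fix w assume "w \<in> ?R"
    then show "rGamma (- (z * w)) / (- (z * w)) = rGamma (1 - z * w)"
      using nz[of w] by (simp add: rGamma_plus1[of "- (z * w)", symmetric])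
  qed
  ultimately show ?thesis by simp
qed

section \<open>Expansion of the reciprocal Gamma product at 0\<close>

lemma zeta_of_nat_sums:
  assumes "n > 1"
  shows "(\<lambda>k. 1 / of_nat (Suc k) ^ n) sums zeta (of_nat n)"
    and "summable (\<lambda>k. 1 / real (Suc k) ^ n)"
proof -
  have "summable (\<lambda>k. inverse (real k ^ n))"
    using assms by (intro inverse_power_summable) auto
  then show summ: "summable (\<lambda>k. 1 / real (Suc k) ^ n)"
    by (subst (asm) summable_Suc_iff[symmetric]) (simp add: divide_inverse)
  have "summable (\<lambda>k. 1 / (of_nat (Suc k) :: complex) ^ n)"
    by (rule summable_norm_cancel) (use summ in \<open>simp add: norm_divide norm_power del: of_nat_Suc\<close>)
  moreover have "zeta (of_nat n) = (\<Sum>k. 1 / of_nat (Suc k) ^ n)"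
    unfolding zeta_def by (intro suminf_cong) (simp add: powr_nat del: of_nat_Suc)
  ultimately show "(\<lambda>k. 1 / of_nat (Suc k) ^ n) sums zeta (of_nat n)"
    by (simp add: summable_sums)
qed

text \<open>Each partial product differs from 1 minus the corresponding partial sum by at most a
  fixed multiple of \<open>norm z ^ (2 * n)\<close>, uniformly in the number of factors. Letting
  that number grow and dividing by \<open>z ^ n\<close> leaves an error of order
  \<open>norm z ^ n\<close>.\<close>

lemma prod_rGamma_roots_unity_expansion:
  assumes "n > 1"
  shows "((\<lambda>z. ((\<Prod>w | w ^ n = 1. rGamma (1 - z * w)) - 1) / z ^ n)
           \<longlongrightarrow> - zeta (of_nat n)) (at 0)"
proof -
  define G :: "complex \<Rightarrow> complex" where "G = (\<lambda>z. \<Prod>w | w ^ n = 1. rGamma (1 - z * w))"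
  define M where "M = (\<Sum>k. 1 / real (Suc k) ^ n)"
  note summ = zeta_of_nat_sums[OF assms]
  \<comment> \<open>The condition on \<open>z\<close> keeps the sum of the norms at most 1, as the
    quadratic estimate requires.\<close>
  have bound: "norm (G z - 1 + zeta (of_nat n) * z ^ n) \<le> (M * norm z ^ n)\<^sup>2"
    if "M * norm z ^ n \<le> 1" for z
  proof (rule tendsto_upperbound)
    have "(\<lambda>N. \<Sum>k<N. z ^ n / of_nat (Suc k) ^ n) \<longlonglongrightarrow> zeta (of_nat n) * z ^ n"
      using sums_mult2[OF summ(1), of "z ^ n"] by (simp add: sums_def)
    then show "(\<lambda>N. norm ((\<Prod>k<N. 1 - z ^ n / of_nat (Suc k) ^ n) - 1
                  + (\<Sum>k<N. z ^ n / of_nat (Suc k) ^ n)))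
        \<longlonglongrightarrow> norm (G z - 1 + zeta (of_nat n) * z ^ n)"
      unfolding G_def using assms by (intro tendsto_intros prod_rGamma_roots_unity)
    show "\<forall>\<^sub>F N in sequentially. norm ((\<Prod>k<N. 1 - z ^ n / of_nat (Suc k) ^ n) - 1
                  + (\<Sum>k<N. z ^ n / of_nat (Suc k) ^ n)) \<le> (M * norm z ^ n)\<^sup>2"
    proof (intro always_eventually allI norm_prod_one_minus_quadratic_le that)
      fix N
      have "(\<Sum>k<N. norm (z ^ n / of_nat (Suc k) ^ n)) = (\<Sum>k<N. 1 / real (Suc k) ^ n) * norm z ^ n"
        by (simp add: norm_divide norm_power sum_distrib_right del: of_nat_Suc)
      also have "\<dots> \<le> M * norm z ^ n"
        unfolding M_def by (intro mult_right_mono sum_le_suminf summ(2)) auto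
      finally show "(\<Sum>k<N. norm (z ^ n / of_nat (Suc k) ^ n)) \<le> M * norm z ^ n" .
    qed auto
  qed auto
  have "((\<lambda>z :: complex. M * norm z ^ n) \<longlongrightarrow> M * norm (0 :: complex) ^ n) (at 0)"
    by (intro tendsto_intros)
  then have "\<forall>\<^sub>F z :: complex in at 0. M * norm z ^ n < 1"
    using assms by (intro order_tendstoD) (auto simp: power_0_left)
  moreover have "\<forall>\<^sub>F z :: complex in at 0. z \<noteq> 0"
    by (simp add: eventually_at_filter)
  ultimately have "\<forall>\<^sub>F z in at 0.
      norm ((G z - 1) / z ^ n - (- zeta (of_nat n))) \<le> M\<^sup>2 * norm z ^ n"
  proof eventually_elim
    case (elim z)
    have "(G z - 1) / z ^ n - (- zeta (of_nat n)) = (G z - 1 + zeta (of_nat n) * z ^ n) / z ^ n"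
      using elim by (simp add: field_simps)
    also have "norm \<dots> \<le> (M * norm z ^ n)\<^sup>2 / norm z ^ n"
      unfolding norm_divide norm_power using elim by (intro divide_right_mono bound) auto
    also have "\<dots> = M\<^sup>2 * norm z ^ n"
      using elim by (simp add: power2_eq_square)
    finally show ?case .
  qed
  moreover have "((\<lambda>z :: complex. M\<^sup>2 * norm z ^ n) \<longlongrightarrow> M\<^sup>2 * norm (0 :: complex) ^ n) (at 0)"
    by (intro tendsto_intros)
  then have "((\<lambda>z :: complex. M\<^sup>2 * norm z ^ n) \<longlongrightarrow> 0) (at 0)"
    using assms by (simp add: power_0_left)
  ultimately have "((\<lambda>z. (G z - 1) / z ^ n - (- zeta (of_nat n))) \<longlongrightarrow> 0) (at 0)"
    by (rule Lim_null_comparison)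
  then show ?thesis
    unfolding G_def by (rule LIM_zero_cancel)
qed

section \<open>Derivatives from an asymptotic expansion\<close>

text \<open>The remainder \<open>h\<close> is \<open>o(z^n)\<close>, so Cauchy's inequality on
  circles of radius \<open>r\<close> bounds its \<open>n\<close>-th derivative at 0 by
  \<open>fact n * o(r^n) / r^n\<close>, which is arbitrarily small.\<close>

lemma higher_deriv_eq_fact_mult_limit:
  fixes f :: "complex \<Rightarrow> complex"
  assumes holo: "f holomorphic_on ball 0 R" and "R > 0" and "n > 0"
    and lim: "((\<lambda>z. (f z - c) / z ^ n) \<longlongrightarrow> l) (at 0)"
  shows "(deriv ^^ n) f 0 = fact n * l"
proof -
  define h where "h = (\<lambda>z. f z - (c + l * z ^ n))"
  have holoh: "h holomorphic_on ball 0 R"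
    unfolding h_def by (intro holomorphic_intros holo)
  \<comment> \<open>The powers are written \<open>(z - 0) ^ n\<close> to match
    \<open>higher_deriv_power\<close>.\<close>
  have "(deriv ^^ n) (\<lambda>z. f z - (c + l * (z - 0) ^ n)) 0
      = (deriv ^^ n) f 0 - (deriv ^^ n) (\<lambda>z. c + l * (z - 0) ^ n) 0"
    using \<open>R > 0\<close> by (intro higher_deriv_diff[of _ "ball 0 R"] holo holomorphic_intros) auto
  also have "(deriv ^^ n) (\<lambda>z :: complex. c + l * (z - 0) ^ n) 0
      = (deriv ^^ n) (\<lambda>z. c) 0 + (deriv ^^ n) (\<lambda>z. l * (z - 0) ^ n) 0"
    by (intro higher_deriv_add[of _ UNIV] holomorphic_intros) auto
  also have "(deriv ^^ n) (\<lambda>z :: complex. l * (z - 0) ^ n) 0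
      = l * (deriv ^^ n) (\<lambda>z. (z - 0) ^ n) 0"
    by (intro higher_deriv_cmult[of _ UNIV] holomorphic_intros) auto
  also have "(deriv ^^ n) (\<lambda>z :: complex. (z - 0) ^ n) 0 = fact n"
    by (subst higher_deriv_power) (simp add: pochhammer_fact add.commute)
  finally have deriv_h: "(deriv ^^ n) h 0 = (deriv ^^ n) f 0 - fact n * l"
    using \<open>n > 0\<close> by (simp add: h_def mult.commute)
  have "norm ((deriv ^^ n) h 0) \<le> 0 + \<epsilon>" if "\<epsilon> > 0" for \<epsilon>
  proof -
    \<comment> \<open>Chosen to cancel the factor \<open>fact n\<close> in Cauchy's
      inequality.\<close>
    define \<delta> where "\<delta> = \<epsilon> / fact n"
    have "\<delta> > 0" using that by (simp add: \<delta>_def)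
    then obtain d where d: "d > 0"
      "\<And>z. z \<noteq> 0 \<Longrightarrow> norm z < d \<Longrightarrow> norm ((f z - c) / z ^ n - l) < \<delta>"
      using LIM_D[OF lim] by (metis diff_zero)
    \<comment> \<open>Strictly below both radii: the closed disc stays inside the domain of
      \<open>f\<close>, and the limit estimate holds on its boundary circle.\<close>
    define r where "r = min d R / 2"
    have r: "0 < r" "r < d" "r < R"
      using d \<open>R > 0\<close> by (auto simp: r_def min_def)
    have "norm ((deriv ^^ n) h 0) \<le> fact n * (\<delta> * r ^ n) / r ^ n"
    proof (rule Cauchy_inequality[OF _ _ \<open>0 < r\<close>])
      show "h holomorphic_on ball 0 r"
        using holoh by (rule holomorphic_on_subset) (use r in auto)
      show "continuous_on (cball 0 r) h"
        by (intro holomorphic_on_imp_continuous_on holomorphic_on_subset[OF holoh]) (use r in auto)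
      fix z :: complex assume "norm (0 - z) = r"
      then have z: "norm z = r" "z \<noteq> 0" using r by auto
      have "h z = ((f z - c) / z ^ n - l) * z ^ n"
        using z(2) by (simp add: h_def field_simps)
      then have "norm (h z) = norm ((f z - c) / z ^ n - l) * r ^ n"
        by (simp only: norm_mult norm_power z(1))
      also have "\<dots> \<le> \<delta> * r ^ n"
        using d(2)[of z] z r by (intro mult_right_mono less_imp_le) auto
      finally show "norm (h z) \<le> \<delta> * r ^ n" .
    qed
    then show ?thesis using r by (simp add: \<delta>_def)
  qed
  then have "norm ((deriv ^^ n) h 0) \<le> 0"
    by (rule field_le_epsilon)
  then show ?thesis using deriv_h by simp
qed

section \<open>The Gamma product and its derivative at 0\<close>

text \<open>The values \<open>e (j/n)\<close> for \<open>j < n\<close> run through the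
  \<open>n\<close>-th roots of unity once each.\<close>

lemma prod_e_eq_prod_roots_unity:
  assumes "n > 0"
  shows "(\<Prod>j=0..n-1. g (e (real j / real n))) = (\<Prod>w | w ^ n = 1. g w)"
proof -
  have "e (real j / real n) = cis (2 * pi * real j / real n)" for j
    by (simp add: e_def cis_conv_exp mult_ac)
  moreover have "{0..n-1} = {..<n}"
    using assms by auto
  ultimately show ?thesis
    using prod.reindex_bij_betw[OF Complex.bij_betw_roots_unity[OF assms], of g] by simp
qed

theorem theorem5p5:
  fixes n :: nat
  assumes "n > 1"
  shows "\<exists>L. ((\<lambda>x::real. (deriv ^^ n)
                   (\<lambda>z::complex. \<Prod>j=0..n-1. Gamma (1 - z * e (real j / real n)))
                   (complex_of_real x)) \<longlongrightarrow> L) (at_right 0)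
             \<and> zeta (of_nat n) = 1 / fact n * L"
proof -
  define F :: "complex \<Rightarrow> complex" where "F = (\<lambda>z. \<Prod>w | w ^ n = 1. Gamma (1 - z * w))"
  define G :: "complex \<Rightarrow> complex" where "G = (\<lambda>z. \<Prod>w | w ^ n = 1. rGamma (1 - z * w))"
  have n: "n > 0" using assms by simp
  have F_eq: "(\<lambda>z. \<Prod>j=0..n-1. Gamma (1 - z * e (real j / real n))) = F"
    unfolding F_def by (intro ext prod_e_eq_prod_roots_unity n)
  \<comment> \<open>Since \<open>norm (z * w) < 1\<close>, the argument of \<open>Gamma\<close> has
    positive real part.\<close>
  have not_pole: "1 - z * w \<notin> \<int>\<^sub>\<le>\<^sub>0" if "z \<in> ball 0 1" "w ^ n = 1" for z w :: complex
  proof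
    assume "1 - z * w \<in> \<int>\<^sub>\<le>\<^sub>0"
    then obtain m where "1 - z * w = of_int m" "m \<le> 0"
      by (elim nonpos_Ints_cases)
    then have "Re (1 - z * w) \<le> 0"
      by (simp del: minus_complex.simps)
    moreover have "norm w = 1"
      using that n by (metis norm_power norm_one power_eq_1_iff norm_ge_zero less_irrefl)
    then have "Re (z * w) < 1"
      using that complex_Re_le_cmod[of "z * w"] by (simp add: norm_mult)
    ultimately show False by simp
  qed
  have holo: "F holomorphic_on ball 0 1"
    unfolding F_def using not_pole by (auto intro!: holomorphic_intros)
  \<comment> \<open>The derivative is continuous at 0, so the one-sided limit is simply its value
    there.\<close>
  have "(\<lambda>z. (deriv ^^ n) F z) holomorphic_on ball 0 1"
    by (intro holomorphic_higher_deriv holo) auto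
  then have "isCont ((deriv ^^ n) F) (complex_of_real 0)"
    by (auto intro!: continuous_on_interior holomorphic_on_imp_continuous_on simp: interior_open)
  then have lim: "((\<lambda>x::real. (deriv ^^ n) F (complex_of_real x)) \<longlongrightarrow> (deriv ^^ n) F 0) (at_right 0)"
    using isCont_tendsto_compose[of "complex_of_real 0" "(deriv ^^ n) F" complex_of_real "at_right 0"]
      tendsto_of_real[OF tendsto_ident_at[of 0 "{0<..}"]]
    by simp
  have F1: "(F \<longlongrightarrow> 1) (at 0)"
  proof -
    have "isCont F 0"
      using holo by (auto intro!: continuous_on_interior holomorphic_on_imp_continuous_on simp: interior_open)
    then show ?thesis by (simp add: isCont_def F_def)
  qed
  have FG: "F z * G z = 1" if "z \<in> ball 0 1" for z
    unfolding F_def G_def prod.distrib[symmetric]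
    using not_pole[OF that] by (intro prod.neutral) (simp add: rGamma_inverse_Gamma Gamma_eq_zero_iff)
  \<comment> \<open>From \<open>F z * G z = 1\<close> follows
    \<open>F z - 1 = - F z * (G z - 1)\<close>; as \<open>F\<close> tends to 1, the expansion of
    \<open>G\<close> passes to \<open>F\<close> with the opposite sign.\<close>
  have "((\<lambda>z. - (F z * ((G z - 1) / z ^ n))) \<longlongrightarrow> - (1 * - zeta (of_nat n))) (at 0)"
    unfolding G_def by (intro tendsto_intros F1 prod_rGamma_roots_unity_expansion assms)
  then have "((\<lambda>z. (F z - 1) / z ^ n) \<longlongrightarrow> zeta (of_nat n)) (at 0)"
    unfolding mult_1_left minus_minus
  proof (rule Lim_transform_eventually)
    have "\<forall>\<^sub>F z :: complex in at 0. z \<in> ball 0 1"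
      by (intro eventually_at_in_open') auto
    then show "\<forall>\<^sub>F z in at 0. - (F z * ((G z - 1) / z ^ n)) = (F z - 1) / z ^ n"
      by eventually_elim (simp add: right_diff_distrib FG minus_divide_left)
  qed
  then have "(deriv ^^ n) F 0 = fact n * zeta (of_nat n)"
    by (intro higher_deriv_eq_fact_mult_limit[OF holo _ n]) auto
  then show ?thesis
    unfolding F_eq using lim by (intro exI[of _ "(deriv ^^ n) F 0"]) simp
qed

end
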